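(* Let $f\in\mathcal{A}$ have finite exclusion type $n$, with associated subgraph $H\subseteq G_n$ (so $\boldsymbol{\sigma}_m(f)=\pi_{m,n}^{-1}(\mathrm{Path}_{m-n}(H))$ for all $m\ge n$). If $H$ contains a partially driftless loop, then $|\boldsymbol{\sigma}_N(f)|$ grows super-exponentially: for every $c\in\mathbb{R}$, $|\boldsymbol{\sigma}_N(f)|>c^N$ for all sufficiently large $N$.
   Context: $I=[0,1]$, $[n]=\{1,\dots,n\}$. For distinct reals $y_1,\dots,y_n$, $\mathrm{Order}(y_1,\dots,y_n)$ is the unique $\sigma\in S_n$ with $y_i<y_j$ iff $\sigma(i)<\sigma(j)$. $\rho,\rho':S_{k+1}\to S_k$: $\rho(\sigma)=\mathrm{Order}(\sigma(1),\dots,\sigma(k))$, $\rho'(\sigma)=\mathrm{Order}(\sigma(2),\dots,\sigma(k+1))$. $\mathcal{A}$ is the set of $f:I\to I$ such that Lebesgue-almost every $x$ has infinite orbit. For $f\in\mathcal{A}$, $\boldsymbol{\sigma}_m(f)\subseteq S_m$ is the set of permutations $\mathrm{Order}(x,f(x),\dots,f^{m-1}(x))$ for $x$ with infinite orbit. The permutation digraph $G_k$ has vertex set $S_k$ and edge set $S_{k+1}$, edge $e$ directed from $\rho(e)$ to $\rho'(e)$. A path of length $\ell$ is $(v_0,e_1,v_1,\dots,e_\ell,v_\ell)$ with $e_i$ directed from $v_{i-1}$ to $v_i$; a loop is a finite path with $v_\ell=v_0$. For a subgraph $H$, $\mathrm{Path}_\ell(H)$ is the set of length-$\ell$ paths using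 only vertices and edges of $H$. Projection: for a path $p=(v_0,e_1,\dots,v_\ell)$ in $G_{k+1}$, $\pi_{k+1,k}(p)=(\rho(v_0),v_0,\rho'(v_0),v_1,\rho'(v_1),\dots,v_\ell,\rho'(v_\ell))$, a path of length $\ell+1$ in $G_k$; $\pi_{m,k}=\pi_{k+1,k}\circ\cdots\circ\pi_{m,m-1}$ (identity if $m=k$). Elements of $S_m$ are regarded as length-$0$ paths in $G_m$, so $\pi_{m,n}^{-1}(\mathrm{Path}_{m-n}(H))$ denotes the set of $\sigma\in S_m$ with $\pi_{m,n}(\sigma)\in\mathrm{Path}_{m-n}(H)$. $f$ has exclusion type $n$ if there is a subgraph $H\subseteq G_n$ with $\boldsymbol{\sigma}_m(f)=\pi_{m,n}^{-1}(\mathrm{Path}_{m-n}(H))$ for all $m\ge n$. Poset and drift: for a path $p$ of length $\ell$ in $G_n$ let $Q_p=\{x_1,\dots,x_{\ell+n}\}$ with $\le$ the reflexive-transitive closure of: $x_{a+c}\le x_{a+d}$ when $0\le a\le\ell$, $c,d\in[n]$, $v_a(c)\le v_a(d)$; $x_{a-1+c}\le x_{a-1+d}$ when $1\le a\le\ell$, $c,d\in[n+1]$, $e_a(c)\le e_a(d)$. For a loop $\gamma$ of length $\ell\ge1$ and $i\in[n]$, $\mathrm{Drift}_\gamma(i)=+$ if $x_i\le x_{\ell+i}$, $-$ if $x_i\ge x_{\ell+i}$, $0$ otherwise. $\gamma$ is partially driftless if $\mathrm{Drift}_\gamma(i)=0$ for some $i\in[n]$. *)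

theory Defs
  imports
    "HOL-Analysis.Analysis"
    "HOL-Combinatorics.Permutations"
    "Graph_Theory.Digraph_Component"
begin

section \<open>Order patterns\<close>

text \<open>A permutation in $S_n$ is a function on \<open>nat\<close> that permutes \<open>{1..n}\<close> (and hence fixes all
  other numbers); a tuple $(y_1, \dots, y_n)$ is a function on \<open>nat\<close> of which only the values at
  \<open>1, \<dots>, n\<close> matter.\<close>

type_synonym perm = "nat \<Rightarrow> nat"

definition Sym :: "nat \<Rightarrow> perm set" where
  "Sym n = {\<sigma>. \<sigma> permutes {1..n}}"

definition Order :: "nat \<Rightarrow> (nat \<Rightarrow> 'a::linorder) \<Rightarrow> perm" where
  "Order n y = (THE \<sigma>. \<sigma> \<in> Sym n \<and> (\<forall>i\<in>{1..n}. \<forall>j\<in>{1..n}. y i < y j \<longleftrightarrow> \<sigma> i < \<sigma> j))"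

definition \<rho> :: "nat \<Rightarrow> perm \<Rightarrow> perm" where
  "\<rho> k \<sigma> = Order k \<sigma>"

definition \<rho>' :: "nat \<Rightarrow> perm \<Rightarrow> perm" where
  "\<rho>' k \<sigma> = Order k (\<lambda>i. \<sigma> (i + 1))"

lemma Order_ex1:
  fixes y :: "nat \<Rightarrow> 'a::linorder"
  assumes inj: "inj_on y {1..n}"
  shows "\<exists>!\<sigma>. \<sigma> \<in> Sym n \<and> (\<forall>i\<in>{1..n}. \<forall>j\<in>{1..n}. y i < y j \<longleftrightarrow> \<sigma> i < \<sigma> j)"
proof -
  define L where "L i = {j \<in> {1..n}. y j \<le> y i}" for i
  define s where "s i = (if i \<in> {1..n} then card (L i) else i)" for i
  have fin: "finite (L i)" for i unfolding L_def by simp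
  have less: "card (L i) < card (L j)" if "i \<in> {1..n}" "j \<in> {1..n}" "y i < y j" for i j
  proof (rule psubset_card_mono[OF fin])
    have "j \<in> L j - L i" using that unfolding L_def by auto
    moreover have "L i \<subseteq> L j" using that unfolding L_def by auto
    ultimately show "L i \<subset> L j" by blast
  qed
  have iff: "y i < y j \<longleftrightarrow> s i < s j" if "i \<in> {1..n}" "j \<in> {1..n}" for i j
  proof
    assume "y i < y j" then show "s i < s j" using less that unfolding s_def by auto
  next
    assume "s i < s j"
    then have "\<not> y j < y i" "i \<noteq> j" using less[of j i] that unfolding s_def by auto
    moreover have "y i \<noteq> y j" using inj_onD[OF inj _ that] \<open>i \<noteq> j\<close> by blast
    ultimately show "y i < y j" by simp
  qed
  have injs: "inj_on s {1..n}"
  proof (rule inj_onI)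
    fix i j assume ij: "i \<in> {1..n}" "j \<in> {1..n}" and eq: "s i = s j"
    have "\<not> y i < y j" "\<not> y j < y i" using iff[OF ij] iff[OF ij(2,1)] eq by simp_all
    then have "y i = y j" by simp
    then show "i = j" using inj_onD[OF inj _ ij] by blast
  qed
  have "s i \<in> {1..n}" if "i \<in> {1..n}" for i
  proof -
    have "i \<in> L i" using that unfolding L_def by simp
    then have "0 < card (L i)" using fin card_gt_0_iff by blast
    moreover have "card (L i) \<le> card {1..n}"
      by (rule card_mono) (auto simp: L_def)
    ultimately show ?thesis using that unfolding s_def by simp
  qed
  then have "bij_betw s {1..n} {1..n}"
    using injs by (simp add: bij_betw_def endo_inj_surj image_subset_iff)
  then have perm: "s \<in> Sym n"
    unfolding Sym_def mem_Collect_eq by (rule bij_imp_permutes) (simp only: s_def if_False)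
  have uniq: "t = s"
    if t: "t \<in> Sym n" and lt: "\<forall>i\<in>{1..n}. \<forall>j\<in>{1..n}. y i < y j \<longleftrightarrow> t i < t j" for t
  proof
    fix i
    have tp: "t permutes {1..n}" using t unfolding Sym_def by simp
    show "t i = s i"
    proof (cases "i \<in> {1..n}")
      case False
      then show ?thesis using tp unfolding s_def by (auto simp: permutes_not_in)
    next
      case True
      then have ti: "t i \<in> {1..n}" using permutes_in_image[OF tp] by blast
      have "y j \<le> y i \<longleftrightarrow> t j \<le> t i" if "j \<in> {1..n}" for j
        using lt[rule_format, OF True that] by (simp add: not_less[symmetric])
      then have Lt: "L i = {j \<in> {1..n}. t j \<le> t i}" unfolding L_def by blast
      have "t ` L i = {k \<in> t ` {1..n}. k \<le> t i}" unfolding Lt by blast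
      also have "\<dots> = {1..t i}" using permutes_image[OF tp] ti by auto
      finally have "t ` L i = {1..t i}" .
      moreover have "inj_on t (L i)" using permutes_inj_on[OF tp] by blast
      ultimately have "card {1..t i} = card (L i)" using card_image by metis
      then have "card (L i) = t i" by simp
      then show ?thesis using True unfolding s_def by simp
    qed
  qed
  show ?thesis
  proof (rule ex1I)
    show "s \<in> Sym n \<and> (\<forall>i\<in>{1..n}. \<forall>j\<in>{1..n}. y i < y j \<longleftrightarrow> s i < s j)"
      using perm iff by blast
  qed (blast intro: uniq)
qed

lemma Order_in_Sym: "inj_on y {1..n} \<Longrightarrow> Order n y \<in> Sym n"
  unfolding Order_def using theI'[OF Order_ex1] by blast

lemma Order_less_iff:
  "inj_on y {1..n} \<Longrightarrow> i \<in> {1..n} \<Longrightarrow> j \<in> {1..n} \<Longrightarrow> Order n y i < Order n y j \<longleftrightarrow> y i < y j"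
  unfolding Order_def using theI'[OF Order_ex1] by blast

lemma \<rho>_in_Sym: "\<sigma> \<in> Sym (k + 1) \<Longrightarrow> \<rho> k \<sigma> \<in> Sym k"
  unfolding \<rho>_def Sym_def[of "k + 1"] by (intro Order_in_Sym) (simp add: permutes_inj_on)

lemma \<rho>'_in_Sym: "\<sigma> \<in> Sym (k + 1) \<Longrightarrow> \<rho>' k \<sigma> \<in> Sym k"
  unfolding \<rho>'_def Sym_def[of "k + 1"]
  by (intro Order_in_Sym inj_onI) (auto dest: permutes_inj injD)


section \<open>Order patterns of interval maps\<close>

definition infinite_orbit :: "(real \<Rightarrow> real) \<Rightarrow> real \<Rightarrow> bool" where
  "infinite_orbit f x \<longleftrightarrow> infinite (range (\<lambda>k. (f ^^ k) x))"

text \<open>The elements of \<open>\<A>\<close> are not assumed measurable; \<open>AE\<close> for \<open>lebesgue_on {0..1}\<close> only requires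
  the exceptional set to be contained in (hence to be) a Lebesgue null set.\<close>

definition \<A> :: "(real \<Rightarrow> real) set" where
  "\<A> = {f \<in> {0..1} \<rightarrow> {0..1}. AE x in lebesgue_on {0..1}. infinite_orbit f x}"

definition patterns :: "nat \<Rightarrow> (real \<Rightarrow> real) \<Rightarrow> perm set" where
  "patterns m f = {Order m (\<lambda>i. (f ^^ (i - 1)) x) | x. x \<in> {0..1} \<and> infinite_orbit f x}"


section \<open>Permutation digraphs, paths and projections\<close>

definition perm_digraph :: "nat \<Rightarrow> (perm, perm) pre_digraph" where
  "perm_digraph k = \<lparr>verts = Sym k, arcs = Sym (k + 1), tail = \<rho> k, head = \<rho>' k\<rparr>"

lemma wf_perm_digraph: "wf_digraph (perm_digraph k)"
  by unfold_locales (auto simp: perm_digraph_def intro: \<rho>_in_Sym[simplified] \<rho>'_in_Sym[simplified])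

text \<open>The path $(v_0, e_1, v_1, \dots, e_\ell, v_\ell)$ is the pair of the lists
  $[v_0, \dots, v_\ell]$ and $[e_1, \dots, e_\ell]$, so $v_a$ is \<open>vs ! a\<close> but $e_a$ is
  \<open>es ! (a - 1)\<close>.\<close>

type_synonym path = "perm list \<times> perm list"

definition Path :: "nat \<Rightarrow> (perm, perm) pre_digraph \<Rightarrow> path set" where
  "Path l H = {(vs, es). length vs = l + 1 \<and> length es = l \<and>
     set vs \<subseteq> verts H \<and> set es \<subseteq> arcs H \<and>
     (\<forall>i<l. tail H (es ! i) = vs ! i \<and> head H (es ! i) = vs ! (i + 1))}"

definition Loop :: "nat \<Rightarrow> (perm, perm) pre_digraph \<Rightarrow> path set" where
  "Loop l H = {(vs, es) \<in> Path l H. last vs = hd vs}"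

text \<open>\<open>proj1 k\<close> is $\pi_{k+1,k}$ and \<open>proj m k\<close> is $\pi_{m,k}$ (for \<open>m \<ge> k\<close>; for \<open>m < k\<close> it is a
  dummy).\<close>

definition proj1 :: "nat \<Rightarrow> path \<Rightarrow> path" where
  "proj1 k = (\<lambda>(vs, es). (\<rho> k (hd vs) # map (\<rho>' k) vs, vs))"

primrec proj :: "nat \<Rightarrow> nat \<Rightarrow> path \<Rightarrow> path" where
  "proj 0 k = id"
| "proj (Suc m) k = (if Suc m \<le> k then id else proj m k \<circ> proj1 m)"

definition exclusion_graph :: "(real \<Rightarrow> real) \<Rightarrow> nat \<Rightarrow> (perm, perm) pre_digraph \<Rightarrow> bool" where
  "exclusion_graph f n H \<longleftrightarrow> subgraph H (perm_digraph n) \<and>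
     (\<forall>m\<ge>n. patterns m f = {\<sigma> \<in> Sym m. proj m n ([\<sigma>], []) \<in> Path (m - n) H})"


section \<open>Drift\<close>

text \<open>The point $x_i$ of $Q_p$ is represented by its index \<open>i \<in> {1..l + n}\<close>. As a relation on all of
  \<open>nat\<close>, \<open>Q_le n p\<close> relates indices outside this range only to themselves.\<close>

definition Q_gen :: "nat \<Rightarrow> path \<Rightarrow> (nat \<times> nat) set" where
  "Q_gen n = (\<lambda>(vs, es).
     {(a + c, a + d) | a c d. 0 \<le> a \<and> a \<le> length es \<and> c \<in> {1..n} \<and> d \<in> {1..n} \<and>
        (vs ! a) c \<le> (vs ! a) d} \<union>
     {(a - 1 + c, a - 1 + d) | a c d. 1 \<le> a \<and> a \<le> length es \<and> c \<in> {1..n + 1} \<and> d \<in> {1..n + 1} \<and>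
        (es ! (a - 1)) c \<le> (es ! (a - 1)) d})"

definition Q_le :: "nat \<Rightarrow> path \<Rightarrow> nat \<Rightarrow> nat \<Rightarrow> bool" where
  "Q_le n p i j \<longleftrightarrow> (i, j) \<in> (Q_gen n p)\<^sup>*"

datatype drift = Plus | Minus | Zero

definition Drift :: "nat \<Rightarrow> path \<Rightarrow> nat \<Rightarrow> drift" where
  "Drift n \<gamma> i = (let l = length (snd \<gamma>) in
     if Q_le n \<gamma> i (l + i) then Plus else if Q_le n \<gamma> (l + i) i then Minus else Zero)"

definition partially_driftless :: "nat \<Rightarrow> path \<Rightarrow> bool" where
  "partially_driftless n \<gamma> \<longleftrightarrow> (\<exists>i\<in>{1..n}. Drift n \<gamma> i = Zero)"

end

theory Submission
  imports Defs
begin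

text \<open>Repeating the loop $\gamma$ of length $l$ gives patterns whose windows all belong to $H$: these
  are the linear extensions of the order generated by the comparisons within windows. The windows
  over one copy of a vertex are chains, so any relation between \<open>x\<^sub>i\<close> and \<open>x\<^sub>i\<^sub>+\<^sub>k\<^sub>l\<close> factors through the
  chain around \<open>x\<^sub>i\<^sub>+\<^sub>l\<close> and forces, after a shift by \<open>l\<close>, a relation over fewer periods, and finally
  one between \<open>x\<^sub>i\<close> and \<open>x\<^sub>i\<^sub>+\<^sub>l\<close> inside a single copy of $\gamma$. Hence a driftless index \<open>i\<close> yields an
  antichain \<open>x\<^sub>i, x\<^sub>i\<^sub>+\<^sub>l, x\<^sub>i\<^sub>+\<^sub>2\<^sub>l, \<dots>\<close>, whose first $K \approx N / l$ members can be ordered in $K!$ ways.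
  The order is handled through one linear extension, a function \<open>L\<close> from the indices, counted from
  \<open>0\<close>, to the reals.\<close>

section \<open>Order patterns of windows\<close>

text \<open>A tie in \<open>y\<close> would be a tie of the injective \<open>\<sigma>\<close>, so
  \<open>y\<close> is injective too and the uniqueness behind \<open>Order\<close> applies.\<close>

lemma Order_eqI:
  assumes "\<sigma> \<in> Sym n" "\<And>i j. i \<in> {1..n} \<Longrightarrow> j \<in> {1..n} \<Longrightarrow> y i < y j \<longleftrightarrow> \<sigma> i < \<sigma> j"
  shows "Order n y = \<sigma>"
proof -
  have inj\<sigma>: "inj_on \<sigma> {1..n}"
    using assms(1) permutes_inj_on unfolding Sym_def by blast
  have "inj_on y {1..n}"
  proof (rule inj_onI)
    fix i j assume ij: "i \<in> {1..n}" "j \<in> {1..n}" "y i = y j"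
    then have "\<sigma> i = \<sigma> j"
      using assms(2)[of i j] assms(2)[of j i] by (metis less_irrefl linorder_neqE_nat)
    then show "i = j" using inj\<sigma> ij by (auto dest: inj_onD)
  qed
  then show ?thesis
    using Order_ex1[of y n] Order_in_Sym[of y n] Order_less_iff[of y n] assms by blast
qed

lemma \<rho>_Order:
  assumes "inj_on z {1..k + 1}"
  shows "\<rho> k (Order (k + 1) z) = Order k z"
proof -
  have "inj_on z {1..k}" using assms by (rule inj_on_subset) auto
  then show ?thesis unfolding \<rho>_def
    by (intro Order_eqI) (use assms in \<open>auto intro!: Order_in_Sym simp: Order_less_iff\<close>)
qed

lemma inj_on_window:
  assumes "inj_on y {1..m}" "k + a \<le> m"
  shows "inj_on (\<lambda>i::nat. y (i + a)) {1..k}"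
proof (rule inj_onI)
  fix p q assume "p \<in> {1..k}" "q \<in> {1..k}" "y (p + a) = y (q + a)"
  then show "p = q" using inj_onD[OF assms(1), of "p + a" "q + a"] assms(2) by simp
qed

lemma \<rho>'_Order:
  assumes "inj_on z {1..k + 1}"
  shows "\<rho>' k (Order (k + 1) z) = Order k (\<lambda>i. z (i + 1))"
proof -
  have "inj_on (\<lambda>i. z (i + 1)) {1..k}"
    using inj_on_window[OF assms, of k 1] by simp
  then show ?thesis unfolding \<rho>'_def
    by (intro Order_eqI) (use assms in \<open>auto intro!: Order_in_Sym simp: Order_less_iff\<close>)
qed

text \<open>The path in \<open>perm_digraph k\<close> traced by \<open>y 1, ..., y (k + r)\<close>.
  For \<open>r = 0\<close> its only vertex is \<open>Order k y\<close>, so iterated projections of a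
  permutation get a closed form.\<close>

definition windows :: "nat \<Rightarrow> nat \<Rightarrow> (nat \<Rightarrow> 'a::linorder) \<Rightarrow> path" where
  "windows k r y = (map (\<lambda>a. Order k (\<lambda>i. y (i + a))) [0..<r + 1],
                    map (\<lambda>a. Order (k + 1) (\<lambda>i. y (i + a))) [0..<r])"

text \<open>Projection turns the old vertices into edges. Their \<open>\<rho>'\<close>-images are
  the windows at shifts \<open>1, ..., r + 1\<close>; \<open>\<rho>\<close> of the first one
  supplies shift \<open>0\<close>.\<close>

lemma proj1_windows:
  assumes "inj_on y {1..k + 1 + r}"
  shows "proj1 k (windows (k + 1) r y) = windows k (r + 1) y"
proof -
  have inj: "inj_on (\<lambda>i. y (i + a)) {1..k + 1}" if "a \<le> r" for a
    using inj_on_window[OF assms] that by simp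
  have "map (\<rho>' k) (map (\<lambda>a. Order (k + 1) (\<lambda>i. y (i + a))) [0..<r + 1]) =
        map (\<lambda>a. Order k (\<lambda>i. y (i + a))) (map Suc [0..<r + 1])"
    unfolding map_map by (intro map_cong) (use \<rho>'_Order[OF inj] in auto)
  moreover have "\<rho> k (Order (k + 1) (\<lambda>i. y (i + 0))) = Order k (\<lambda>i. y (i + 0))"
    by (rule \<rho>_Order[OF inj]) simp
  moreover have "[0..<r + 1 + 1] = 0 # map Suc [0..<r + 1]"
    by (simp add: map_Suc_upt upt_conv_Cons del: upt_Suc)
  moreover have "hd (map (\<lambda>a. Order (k + 1) (\<lambda>i. y (i + a))) [0..<r + 1]) = Order (k + 1) (\<lambda>i. y (i + 0))"
    by (simp add: hd_map hd_upt del: upt_Suc)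
  ultimately show ?thesis
    unfolding proj1_def windows_def by (simp del: upt_Suc map_map)
qed

text \<open>Each projection shortens the windows by one and lengthens the path by one, so the
  induction runs over all \<open>r\<close>.\<close>

lemma proj_windows:
  "k \<le> m \<Longrightarrow> inj_on y {1..m + r} \<Longrightarrow> proj m k (windows m r y) = windows k (m - k + r) y"
proof (induction m arbitrary: r)
  case (Suc m)
  show ?case
  proof (cases "Suc m \<le> k")
    case False
    then have "proj (Suc m) k (windows (Suc m) r y) = proj m k (windows m (r + 1) y)"
      using proj1_windows[of y m r] Suc.prems by simp
    also have "\<dots> = windows k (m - k + (r + 1)) y"
      using Suc False by (intro Suc.IH) auto
    finally show ?thesis using False by (simp add: Suc_diff_le)
  next
    case True
    then have "k = Suc m" using Suc.prems by simp
    then show ?thesis by simp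
  qed
qed simp

text \<open>A subgraph contains the ends of its arcs, so arcs suffice; the arc at shift
  \<open>r\<close> lies one past the path and supplies its last vertex as a tail.\<close>

lemma windows_in_Path:
  assumes H: "subgraph H (perm_digraph n)" and inj: "inj_on y {1..n + r + 1}"
    and arcs: "\<And>a. a \<le> r \<Longrightarrow> Order (n + 1) (\<lambda>i. y (i + a)) \<in> arcs H"
  shows "windows n r y \<in> Path r H"
proof -
  interpret wf_digraph H using H by (auto simp: subgraph_def)
  have th: "tail H = \<rho> n" "head H = \<rho>' n"
    using H by (auto simp: subgraph_def compatible_def perm_digraph_def)
  have inj': "inj_on (\<lambda>i. y (i + a)) {1..n + 1}" if "a \<le> r" for a
    using inj_on_window[OF inj] that by simp
  have tl: "tail H (Order (n + 1) (\<lambda>i. y (i + a))) = Order n (\<lambda>i. y (i + a))"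
    and hd: "head H (Order (n + 1) (\<lambda>i. y (i + a))) = Order n (\<lambda>i. y (i + Suc a))" if "a \<le> r" for a
    using \<rho>_Order[OF inj'[OF that]] \<rho>'_Order[OF inj'[OF that]] unfolding th by simp_all
  have "Order n (\<lambda>i. y (i + a)) \<in> verts H" if "a \<le> r" for a
    using tail_in_verts[OF arcs[OF that]] tl[OF that] by simp
  then show ?thesis
    unfolding Path_def windows_def using arcs tl hd
    by (auto simp: less_Suc_eq_le simp del: upt_Suc)
qed

text \<open>The exclusion type enters here: being a pattern is reduced to a condition on windows of
  length \<open>n + 1\<close>. With an infinite \<open>y\<close>, the arc past the end of the path
  is available too.\<close>

lemma pattern_from_windows:
  assumes H: "exclusion_graph f n H" and inj: "inj_on y {1..}" and "n \<le> N"
    and arcs: "\<And>a. Order (n + 1) (\<lambda>i. y (i + a)) \<in> arcs H"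
  shows "Order N y \<in> patterns N f"
proof -
  have inj': "inj_on y {1..m}" for m using inj by (rule inj_on_subset) auto
  have "proj N n ([Order N y], []) = proj N n (windows N 0 y)"
    by (simp add: windows_def)
  also have "\<dots> = windows n (N - n) y"
    using proj_windows[OF \<open>n \<le> N\<close> inj', of 0] by simp
  also have "\<dots> \<in> Path (N - n) H"
    using H arcs by (intro windows_in_Path inj') (auto simp: exclusion_graph_def)
  finally show ?thesis
    using H \<open>n \<le> N\<close> Order_in_Sym[OF inj'] unfolding exclusion_graph_def by auto
qed


section \<open>Realizing compatible local orders\<close>

lemma real_between_finite_sets:
  fixes S T F :: "real set"
  assumes fin: "finite S" "finite T" "finite F" and less: "\<And>s t. s \<in> S \<Longrightarrow> t \<in> T \<Longrightarrow> s < t"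
  shows "\<exists>r. r \<notin> F \<and> (\<forall>s\<in>S. s < r) \<and> (\<forall>t\<in>T. r < t)"
proof -
  \<comment> \<open>The inserted numbers cover empty \<open>S\<close> or \<open>T\<close>:
    \<open>Min (insert 0 T) - 1\<close> is below all of \<open>T\<close>, and \<open>lo + 1\<close>
    is above \<open>lo\<close>.\<close>
  define lo where "lo = Max (insert (Min (insert 0 T) - 1) S)"
  define hi where "hi = Min (insert (lo + 1) T)"
  have "lo < t" if "t \<in> T" for t
  proof -
    have "Min (insert 0 T) \<le> t" using fin that by simp
    then have "\<forall>x\<in>insert (Min (insert 0 T) - 1) S. x < t" using less that by auto
    then show ?thesis unfolding lo_def using fin by (subst Max_less_iff) blast+
  qed
  then have "lo < hi" unfolding hi_def using fin by (subst Min_gr_iff) auto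
  then have "\<exists>r\<in>{lo<..<hi}. r \<notin> F"
    using infinite_Ioo[of lo hi] fin by (meson finite_subset subsetI)
  then obtain r where r: "lo < r" "r < hi" "r \<notin> F" by auto
  have "s < r" if "s \<in> S" for s
  proof -
    have "s \<le> lo" unfolding lo_def using fin that by simp
    with r show ?thesis by simp
  qed
  moreover have "r < t" if "t \<in> T" for t
  proof -
    have "hi \<le> t" unfolding hi_def using fin that by simp
    with r show ?thesis by simp
  qed
  ultimately show ?thesis using r by blast
qed

text \<open>The ranks \<open>E a 0, \<dots>, E a n\<close> prescribe the order of the values at \<open>a, \<dots>, a + n\<close>; the values
  are chosen one after the other, using that the reals are dense.\<close>

lemma ex_realization:
  fixes E :: "nat \<Rightarrow> nat \<Rightarrow> nat"
  assumes injE: "\<And>a. inj_on (E a) {..n}"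
    and shift: "\<And>a c d. c < n \<Longrightarrow> d < n \<Longrightarrow> E a (Suc c) < E a (Suc d) \<longleftrightarrow> E (Suc a) c < E (Suc a) d"
  shows "\<exists>L::nat \<Rightarrow> real. inj L \<and> (\<forall>a. \<forall>c\<le>n. \<forall>d\<le>n. L (a + c) < L (a + d) \<longleftrightarrow> E a c < E a d)"
proof -
  have shifts: "E a (c + j) < E a (d + j) \<longleftrightarrow> E (a + j) c < E (a + j) d"
    if "c + j \<le> n" "d + j \<le> n" for a c d j
    using that
  proof (induction j arbitrary: c d)
    case (Suc j)
    then show ?case using Suc.IH[of "Suc c" "Suc d"] shift[of c d "a + j"] by simp
  qed simp
  \<comment> \<open>\<open>r\<close> may be put at \<open>x\<close>: it is new and compares
    correctly with the earlier values at distance at most \<open>n\<close>. Each pair is judged in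
    the window that starts at its smaller index, which has rank \<open>E z 0\<close> there.\<close>
  define P where "P L x r \<longleftrightarrow> r \<notin> L ` {..<x} \<and>
      (\<forall>z<x. x \<le> z + n \<longrightarrow> (L z < r \<longleftrightarrow> E z 0 < E z (x - z)))" for L :: "nat \<Rightarrow> real" and x r
  \<comment> \<open>\<open>shifts\<close> carries the verdict of that one window to every window
    containing the pair.\<close>
  have window: "L (a + c) < L (a + d) \<longleftrightarrow> E a c < E a d"
    if P: "\<And>x. x < b \<Longrightarrow> P L x (L x)" and ab: "a + c < b" "a + d < b" and cd: "c \<le> n" "d \<le> n" for L a b c d
  proof -
    have up: "L (a + c) < L (a + d) \<longleftrightarrow> E a c < E a d"
      if "c < d" "d \<le> n" "a + d < b" for c d
    proof -
      have "L (a + c) < L (a + d) \<longleftrightarrow> E (a + c) 0 < E (a + c) (d - c)"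
        using P[of "a + d"] that unfolding P_def by auto
      also have "\<dots> \<longleftrightarrow> E a c < E a d"
        using shifts[of 0 c "d - c" a] that by simp
      finally show ?thesis .
    qed
    have ne: "L (a + c) \<noteq> L (a + d) \<and> E a c \<noteq> E a d" if "d < c"
    proof -
      have "L (a + c) \<notin> L ` {..<a + c}" using P[of "a + c"] ab unfolding P_def by auto
      moreover have "L (a + d) \<in> L ` {..<a + c}" using that by simp
      moreover have "E a c \<noteq> E a d" using injE[of a] cd that by (auto dest: inj_onD)
      ultimately show ?thesis by metis
    qed
    consider "c < d" | "c = d" | "d < c" by linarith
    then show ?thesis
    proof cases
      case 3
      then have "L (a + d) < L (a + c) \<longleftrightarrow> E a d < E a c" using up cd ab by blast
      then show ?thesis using ne[OF 3] by linarith
    qed (use up cd ab in auto)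
  qed
  have "\<exists>L. \<forall>x. P L x (L x)"
  \<comment> \<open>The recursion requires that \<open>P L x\<close> depends only on the values of
    \<open>L\<close> below \<open>x\<close>; this is the first goal.\<close>
  proof (rule dependent_wf_choice[OF wf_less])
    fix f g :: "nat \<Rightarrow> real" and x r
    assume "\<And>z. (z, x) \<in> {(x, y). x < y} \<Longrightarrow> f z = g z"
    then have fg: "f z = g z" if "z < x" for z using that by simp
    then have "f ` {..<x} = g ` {..<x}" by (intro image_cong) auto
    then show "P f x r = P g x r" unfolding P_def using fg by auto
  next
    fix x and L :: "nat \<Rightarrow> real"
    assume "\<And>y. (y, x) \<in> {(x, y). x < y} \<Longrightarrow> P L y (L y)"
    then have P: "P L y (L y)" if "y < x" for y using that by simp
    \<comment> \<open>Truncated subtraction: the window at \<open>a\<close> contains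
      \<open>x\<close> and all earlier indices within distance \<open>n\<close>, also when
      \<open>x < n\<close>.\<close>
    define a where "a = x - n"
    define g where "g z = E a (z - a)" for z
    have win: "L u < L v \<longleftrightarrow> g u < g v" if "u \<in> {a..<x}" "v \<in> {a..<x}" for u v
    proof -
      have "u - a \<le> n" "v - a \<le> n" using that unfolding a_def by auto
      then show ?thesis using window[OF P, of x a "u - a" "v - a"] that unfolding g_def by auto
    qed
    have "\<exists>r. r \<notin> L ` {..<x} \<and> (\<forall>s\<in>L ` {z\<in>{a..<x}. g z < g x}. s < r) \<and>
        (\<forall>t\<in>L ` {z\<in>{a..<x}. g x < g z}. r < t)"
      by (rule real_between_finite_sets) (auto simp: win)
    then obtain r where r0: "r \<notin> L ` {..<x} \<and> (\<forall>s\<in>L ` {z\<in>{a..<x}. g z < g x}. s < r) \<and>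
        (\<forall>t\<in>L ` {z\<in>{a..<x}. g x < g z}. r < t)" ..
    have r: "r \<notin> L ` {..<x}" "\<And>z. z \<in> {a..<x} \<Longrightarrow> g z < g x \<Longrightarrow> L z < r"
        "\<And>z. z \<in> {a..<x} \<Longrightarrow> g x < g z \<Longrightarrow> r < L z"
      using r0 by simp_all
    have "L z < r \<longleftrightarrow> E z 0 < E z (x - z)" if z: "z < x" "x \<le> z + n" for z
    proof -
      have za: "z \<in> {a..<x}" using z unfolding a_def by auto
      have "z - a \<le> n" "x - a \<le> n" "z - a \<noteq> x - a" using z unfolding a_def by auto
      then have "g z \<noteq> g x" unfolding g_def
        using inj_onD[OF injE[of a], of "z - a" "x - a"] by auto
      then have "L z < r \<longleftrightarrow> g z < g x" using r(2,3)[OF za] by force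
      also have "\<dots> \<longleftrightarrow> E z 0 < E z (x - z)"
      proof -
        have "a + (z - a) = z" "x - z + (z - a) = x - a" using za z by auto
        then show ?thesis
          unfolding g_def using shifts[of 0 "z - a" "x - z" a] \<open>z - a \<le> n\<close> \<open>x - a \<le> n\<close> by simp
      qed
      finally show ?thesis .
    qed
    then show "\<exists>r. P L x r" unfolding P_def using r(1) by blast
  qed
  then obtain L where L: "\<And>x. P L x (L x)" by blast
  have "inj L"
  proof (rule linorder_injI)
    fix x y :: nat assume "x < y"
    then have "L x \<in> L ` {..<y}" by simp
    then show "L x \<noteq> L y" using L[of y] unfolding P_def by metis
  qed
  moreover have "L (a + c) < L (a + d) \<longleftrightarrow> E a c < E a d" if "c \<le> n" "d \<le> n" for a c d
    using window[OF L, where b = "a + c + d + 1"] that by simp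
  ultimately show ?thesis by blast
qed


section \<open>The order generated by local comparisons\<close>

text \<open>Distance at most \<open>n\<close> means lying in a common window of \<open>n + 1\<close>
  indices, the size that an arc of \<open>perm_digraph n\<close> compares. The closure is the
  partial order that \<open>L\<close> extends linearly.\<close>

definition step :: "nat \<Rightarrow> (nat \<Rightarrow> real) \<Rightarrow> (nat \<times> nat) set" where
  "step n L = {(a, b). a \<le> b + n \<and> b \<le> a + n \<and> L a \<le> L b}"

lemma step_iff: "(a, b) \<in> step n L \<longleftrightarrow> a \<le> b + n \<and> b \<le> a + n \<and> L a \<le> L b"
  by (simp add: step_def)

lemma step_rtrancl_le: "(a, b) \<in> (step n L)\<^sup>* \<Longrightarrow> L a \<le> L b"
  by (induction rule: rtrancl_induct) (auto simp: step_iff)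

text \<open>An excursion beyond the interval leaves and re-enters through \<open>n\<close> consecutive points at one of
  its ends, which are pairwise comparable; hence it can be replaced by a single step.\<close>

lemma step_rtrancl_Restr:
  assumes "(a, b) \<in> (step n L)\<^sup>*" "a \<in> {s..<t + n}" "b \<in> {s..<t + n}" "s \<le> t"
  shows "(a, b) \<in> (Restr (step n L) {s..<t + n})\<^sup>*"
proof -
  define I where "I = {s..<t + n}"
  let ?R = "Restr (step n L) I"
  \<comment> \<open>While the path is outside \<open>I\<close>, the invariant keeps a point
    \<open>w\<close> among the \<open>n\<close> points at that end of \<open>I\<close>, with
    \<open>L w\<close> at most the current value. Steps have length at most \<open>n\<close>, so the
    path cannot jump over \<open>I\<close> and returns among these same points, one step from
    \<open>w\<close>.\<close>
  have "(b \<in> I \<longrightarrow> (a, b) \<in> ?R\<^sup>*) \<and>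
        (t + n \<le> b \<longrightarrow> (\<exists>w\<in>{t..<t + n}. (a, w) \<in> ?R\<^sup>* \<and> L w \<le> L b)) \<and>
        (b < s \<longrightarrow> (\<exists>w\<in>{s..<s + n}. (a, w) \<in> ?R\<^sup>* \<and> L w \<le> L b))"
    using assms(1)
  proof (induction rule: rtrancl_induct)
    case base
    then show ?case using assms(2) unfolding I_def by auto
  next
    case (step y z)
    have yz: "y \<le> z + n" "z \<le> y + n" "L y \<le> L z" using step.hyps(2) by (auto simp: step_iff)
    consider "y \<in> I" | "t + n \<le> y" | "y < s" unfolding I_def by fastforce
    then show ?case
    proof cases
      case 1
      then have ay: "(a, y) \<in> ?R\<^sup>*" using step.IH by simp
      have "(a, z) \<in> ?R\<^sup>*" if "z \<in> I"
        using ay step.hyps(2) 1 that by (meson IntI SigmaI rtrancl.rtrancl_into_rtrancl)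
      moreover have "y \<in> {t..<t + n}" if "t + n \<le> z" using that yz 1 unfolding I_def by auto
      moreover have "y \<in> {s..<s + n}" if "z < s" using that yz 1 unfolding I_def by auto
      ultimately show ?thesis using ay yz by (meson leD)
    next
      case 2
      then obtain w where w: "w \<in> {t..<t + n}" "(a, w) \<in> ?R\<^sup>*" "L w \<le> L y" using step.IH by blast
      have "(w, z) \<in> ?R" if "z \<in> I"
        using that w yz 2 \<open>s \<le> t\<close> unfolding I_def by (auto simp: step_iff)
      then have "z \<in> I \<longrightarrow> (a, z) \<in> ?R\<^sup>*" using w(2) by (meson rtrancl.rtrancl_into_rtrancl)
      moreover have "\<not> z < s" if "n > 0" using 2 yz \<open>s \<le> t\<close> w by auto
      moreover have "n > 0" using w(1) by auto
      ultimately show ?thesis using w yz by (meson order_trans)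
    next
      case 3
      then obtain w where w: "w \<in> {s..<s + n}" "(a, w) \<in> ?R\<^sup>*" "L w \<le> L y" using step.IH by blast
      have "(w, z) \<in> ?R" if "z \<in> I"
        using that w yz 3 \<open>s \<le> t\<close> unfolding I_def by (auto simp: step_iff)
      then have "z \<in> I \<longrightarrow> (a, z) \<in> ?R\<^sup>*" using w(2) by (meson rtrancl.rtrancl_into_rtrancl)
      moreover have "\<not> t + n \<le> z" using 3 yz \<open>s \<le> t\<close> w by auto
      ultimately show ?thesis using w yz by (meson order_trans)
    qed
  qed
  then show ?thesis using assms(3) unfolding I_def by blast
qed

text \<open>Steps have length at most \<open>n\<close>, so \<open>n\<close> consecutive indices
  cannot be jumped over.\<close>

lemma step_rtrancl_through:
  assumes "(a, b) \<in> (step n L)\<^sup>*" "a < t + n" "t \<le> b"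
  shows "\<exists>w\<in>{t..<t + n}. (a, w) \<in> (step n L)\<^sup>* \<and> (w, b) \<in> (step n L)\<^sup>*"
  using assms
proof (induction rule: rtrancl_induct)
  case (step y z)
  show ?case
  proof (cases "t \<le> y")
    case True
    then show ?thesis using step by (meson rtrancl.rtrancl_into_rtrancl)
  next
    case False
    then have "z \<in> {t..<t + n}" using step by (auto simp: step_iff)
    then show ?thesis using step.hyps by (meson rtrancl.simps)
  qed
next
  case base
  then show ?case by auto
qed

text \<open>Only comparisons inside windows are periodic: \<open>L\<close> is one linear extension
  among many, and a shift may change how it orders distant indices.\<close>

definition periodic_order :: "nat \<Rightarrow> (nat \<Rightarrow> real) \<Rightarrow> nat \<Rightarrow> bool" where
  "periodic_order n L l \<longleftrightarrow>
     (\<forall>a b. a \<le> b + n \<longrightarrow> b \<le> a + n \<longrightarrow> (L (a + l) \<le> L (b + l) \<longleftrightarrow> L a \<le> L b))"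

lemma periodic_order_mult:
  assumes "periodic_order n L l"
  shows "periodic_order n L (k * l)"
proof (induction k)
  case (Suc k)
  have "L (a + Suc k * l) \<le> L (b + Suc k * l) \<longleftrightarrow> L a \<le> L b" if "a \<le> b + n" "b \<le> a + n" for a b
  proof -
    have "L (a + Suc k * l) \<le> L (b + Suc k * l) \<longleftrightarrow> L (a + k * l) \<le> L (b + k * l)"
      using assms[unfolded periodic_order_def, rule_format, of "a + k * l" "b + k * l"] that
      by (simp add: algebra_simps)
    also have "\<dots> \<longleftrightarrow> L a \<le> L b" using Suc that unfolding periodic_order_def by blast
    finally show ?thesis .
  qed
  then show ?case unfolding periodic_order_def by blast
qed (simp add: periodic_order_def)

text \<open>The given path may dip below \<open>l\<close>, where indices cannot be lowered by
  \<open>l\<close>; it is first confined to indices from \<open>l\<close> on.\<close>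

lemma step_rtrancl_shift:
  assumes per: "periodic_order n L l" and "(a + l, b + l) \<in> (step n L)\<^sup>*" "n > 0"
  shows "(a, b) \<in> (step n L)\<^sup>*"
proof -
  let ?R = "Restr (step n L) {l..<(l + a + b) + n}"
  have "(a + l, b + l) \<in> ?R\<^sup>*"
    using assms by (intro step_rtrancl_Restr) auto
  then have "(a + l - l, b + l - l) \<in> (step n L)\<^sup>*"
  proof (induction rule: rtrancl_induct)
    case (step y z)
    have "(y - l, z - l) \<in> step n L"
      using step.hyps(2) per[unfolded periodic_order_def, rule_format, of "y - l" "z - l"]
      by (auto simp: step_iff)
    then show ?case using step.IH by (meson rtrancl.rtrancl_into_rtrancl)
  qed simp
  then show ?thesis by simp
qed

text \<open>Induction on the number of periods. The path meets the block \<open>{l..<l + n}\<close>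
  in some \<open>w\<close>, one step away from \<open>l + i\<close>: if \<open>w\<close> is below,
  \<open>no\<close> is contradicted; if above, the rest of the path starts from \<open>l + i\<close>
  and shifts down to one period less.\<close>

lemma not_step_rtrancl_multiple:
  assumes per: "periodic_order n L l" and "i < n"
    and no: "(i, l + i) \<notin> (Restr (step n L) {..<l + n})\<^sup>*"
  shows "(i, i + Suc k * l) \<notin> (step n L)\<^sup>*"
proof (induction k)
  case 0
  show ?case
    using step_rtrancl_Restr[of i "l + i" n L 0 l] assms
    by (auto simp: atLeast0LessThan add.commute)
next
  case (Suc k)
  show ?case
  proof
    assume "(i, i + Suc (Suc k) * l) \<in> (step n L)\<^sup>*"
    then obtain w where w: "w \<in> {l..<l + n}" "(i, w) \<in> (step n L)\<^sup>*"
        "(w, i + Suc (Suc k) * l) \<in> (step n L)\<^sup>*"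
      using step_rtrancl_through[of i "i + Suc (Suc k) * l" n L l] \<open>i < n\<close> by auto
    show False
    proof (cases "L w \<le> L (l + i)")
      case True
      then have "(w, l + i) \<in> step n L" using w(1) \<open>i < n\<close> by (auto simp: step_iff)
      then have "(i, l + i) \<in> (step n L)\<^sup>*" using w(2) by (meson rtrancl.rtrancl_into_rtrancl)
      then show False
        using step_rtrancl_Restr[of i "l + i" n L 0 l] \<open>i < n\<close> no by (auto simp: atLeast0LessThan)
    next
      case False
      then have "(l + i, w) \<in> step n L" using w(1) \<open>i < n\<close> by (auto simp: step_iff)
      then have "(l + i, i + Suc (Suc k) * l) \<in> (step n L)\<^sup>*"
        using w(3) by (rule converse_rtrancl_into_rtrancl)
      moreover have "l + i = i + l" "i + Suc (Suc k) * l = (i + Suc k * l) + l" by simp_all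
      ultimately have "(i + l, (i + Suc k * l) + l) \<in> (step n L)\<^sup>*" by (simp only:)
      then have "(i, i + Suc k * l) \<in> (step n L)\<^sup>*"
        using step_rtrancl_shift[OF per] \<open>i < n\<close> by blast
      then show False using Suc.IH by blast
    qed
  qed
qed

lemma step_uminus: "step n (\<lambda>x. - L x) = (step n L)\<inverse>"
  by (auto simp: step_def)

lemma driftless_antichain:
  assumes per: "periodic_order n L l" and "i < n"
    and no1: "(i, l + i) \<notin> (Restr (step n L) {..<l + n})\<^sup>*"
    and no2: "(l + i, i) \<notin> (Restr (step n L) {..<l + n})\<^sup>*"
    and path: "(i + j * l, i + k * l) \<in> (step n L)\<^sup>*"
  shows "j = k"
proof (rule ccontr)
  assume "j \<noteq> k"
  then consider "j < k" | "k < j" by linarith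
  then show False
  proof cases
    case 1
    then obtain d where d: "k = j + Suc d" using less_iff_Suc_add by auto
    have "(i + j * l, (i + Suc d * l) + j * l) \<in> (step n L)\<^sup>*"
      using path unfolding d by (simp add: algebra_simps)
    then have "(i, i + Suc d * l) \<in> (step n L)\<^sup>*"
      using step_rtrancl_shift[OF periodic_order_mult[OF per]] \<open>i < n\<close> by blast
    then show False using not_step_rtrancl_multiple[OF per \<open>i < n\<close> no1] by blast
  next
    case 2
    then obtain d where d: "j = k + Suc d" using less_iff_Suc_add by auto
    have "((i + Suc d * l) + k * l, i + k * l) \<in> (step n L)\<^sup>*"
      using path unfolding d by (simp add: algebra_simps)
    then have "(i + Suc d * l, i) \<in> (step n L)\<^sup>*"
      using step_rtrancl_shift[OF periodic_order_mult[OF per]] \<open>i < n\<close> by blast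
    \<comment> \<open>Negating \<open>L\<close> reverses all steps, so the result on paths from
      \<open>i\<close> to a later copy applies here as well.\<close>
    then have "(i, i + Suc d * l) \<in> (step n (\<lambda>x. - L x))\<^sup>*"
      unfolding step_uminus by (simp add: rtrancl_converse)
    moreover have "periodic_order n (\<lambda>x. - L x) l"
      using per unfolding periodic_order_def by auto
    moreover have "(i, l + i) \<notin> (Restr (step n (\<lambda>x. - L x)) {..<l + n})\<^sup>*"
    proof -
      have "Restr (step n (\<lambda>x. - L x)) {..<l + n} = (Restr (step n L) {..<l + n})\<inverse>"
        unfolding step_uminus by auto
      then show ?thesis using no2 by (simp add: rtrancl_converse)
    qed
    ultimately show False using not_step_rtrancl_multiple \<open>i < n\<close> by blast
  qed
qed

text \<open>The points strictly below the antichain come first, then the antichain ordered by \<open>w\<close>, then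
  the remaining points.\<close>

lemma ex_reordering_of_antichain:
  fixes L w :: "nat \<Rightarrow> real"
  assumes injL: "inj L" and injw: "inj_on w A" and w: "\<And>a. a \<in> A \<Longrightarrow> 0 < w a \<and> w a \<le> K"
    and anti: "\<And>a b. a \<in> A \<Longrightarrow> b \<in> A \<Longrightarrow> (a, b) \<in> (step n L)\<^sup>* \<Longrightarrow> a = b"
  shows "\<exists>y::nat \<Rightarrow> real. inj y \<and> (\<forall>a\<in>A. y a = w a) \<and>
    (\<forall>u v. u \<le> v + n \<longrightarrow> v \<le> u + n \<longrightarrow> (y u < y v \<longleftrightarrow> L u < L v))"
proof -
  define D where "D = {x. x \<notin> A \<and> (\<exists>a\<in>A. (x, a) \<in> (step n L)\<^sup>*)}"
  \<comment> \<open>\<open>arctan\<close> squeezes the order of \<open>L\<close> into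
    \<open>(-2, 2)\<close>, so the three classes land below \<open>0\<close>, in
    \<open>(0, K]\<close> and above \<open>K\<close>.\<close>
  define y where "y x = (if x \<in> A then w x else if x \<in> D then arctan (L x) - 2 else arctan (L x) + K + 2)" for x
  have arc: "\<bar>arctan t\<bar> < 2" for t
    using arctan_bounded[of t] pi_half_less_two by linarith
  have yA: "y x = w x" "0 < y x" "y x \<le> K" if "x \<in> A" for x
    using that w unfolding y_def by auto
  have yD: "y x = arctan (L x) - 2" "y x < 0" if "x \<in> D" for x
    using that arc[of "L x"] unfolding y_def D_def by auto
  have yU: "y x = arctan (L x) + K + 2" "K < y x" if "x \<notin> A" "x \<notin> D" for x
    using that arc[of "L x"] unfolding y_def by auto
  \<comment> \<open>An empty \<open>A\<close> puts no lower bound on \<open>K\<close>, but then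
    \<open>D\<close> is empty as well.\<close>
  have K: "0 < K" if "x \<in> D" for x
  proof -
    obtain a where "a \<in> A" using \<open>x \<in> D\<close> unfolding D_def by blast
    then show ?thesis using w[of a] by linarith
  qed
  have sepA: "y a \<noteq> y x" if "a \<in> A" "x \<notin> A" for a x
    using yA[OF that(1)] yD[of x] yU[OF that(2)] by (cases "x \<in> D") linarith+
  have sepD: "y d < y x" if "d \<in> D" "x \<notin> A" "x \<notin> D" for d x
    using yD[OF that(1)] yU[OF that(2,3)] K[OF that(1)] by linarith
  have injy: "inj y"
  proof (rule injI)
    fix u v assume eq: "y u = y v"
    consider "u \<in> A" "v \<in> A" | "u \<in> D" "v \<in> D" | "u \<notin> A" "u \<notin> D" "v \<notin> A" "v \<notin> D"
      using eq sepA[of u v] sepA[of v u] sepD[of u v] sepD[of v u] by fastforce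
    then show "u = v"
    proof cases
      case 1
      then show ?thesis using eq yA injw by (auto dest: inj_onD)
    next
      case 2
      then show ?thesis using eq yD injL by (simp add: arctan_eq_iff inj_eq)
    next
      case 3
      then show ?thesis using eq yU injL by (simp add: arctan_eq_iff inj_eq)
    qed
  qed
  \<comment> \<open>\<open>D\<close> is closed downwards, and what lies strictly below a point of
    \<open>A\<close> is in \<open>D\<close>; hence no step leads from a later class to an earlier
    one.\<close>
  have mono: "y u < y v" if uv: "u \<le> v + n" "v \<le> u + n" "L u < L v" for u v
  proof -
    have st: "(u, v) \<in> (step n L)\<^sup>*" using uv by (auto simp: step_iff)
    have un: "\<not> (v, u) \<in> (step n L)\<^sup>*" using step_rtrancl_le[of v u n L] uv by auto
    consider "v \<in> D" | "v \<in> A" | "v \<notin> A" "v \<notin> D" by blast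
    then show ?thesis
    proof cases
      case 1
      then obtain a where a: "a \<in> A" "(v, a) \<in> (step n L)\<^sup>*" unfolding D_def by blast
      then have ua: "(u, a) \<in> (step n L)\<^sup>*" using st by simp
      have "u \<notin> A" using anti[OF _ a(1) ua] a(2) un by blast
      then have "u \<in> D" using ua a unfolding D_def by blast
      then show ?thesis using 1 yD uv by (simp add: arctan_less_iff)
    next
      case 2
      then have "u \<notin> A" using anti[OF _ _ st] uv by blast
      then have "u \<in> D" using 2 st unfolding D_def by blast
      then show ?thesis using yA[OF 2] yD[of u] by linarith
    next
      case 3
      consider "u \<in> D" | "u \<in> A" | "u \<notin> A" "u \<notin> D" by blast
      then show ?thesis
      proof cases
        case 1
        then show ?thesis using sepD 3 by blast
      next
        case 2
        then show ?thesis using yA[OF 2] yU[OF 3] by linarith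
      next
        case u: 3
        then show ?thesis using yU[OF 3] yU[OF u] uv by (simp add: arctan_less_iff)
      qed
    qed
  qed
  have "y u < y v \<longleftrightarrow> L u < L v" if "u \<le> v + n" "v \<le> u + n" for u v
  proof (cases "u = v")
    case False
    then have "L u \<noteq> L v" using injL by (simp add: inj_eq)
    then show ?thesis using mono[OF that] mono[OF that(2,1)] by linarith
  qed simp
  then show ?thesis using injy yA by blast
qed


section \<open>Growth\<close>

text \<open>Every \<open>\<tau>\<close> in \<open>Sym K\<close> is imposed on \<open>K\<close>
  points of the antichain without changing any comparison inside a window; the result is still a
  pattern, and \<open>\<tau>\<close> can be read off from it.\<close>

lemma card_patterns_ge_fact:
  assumes H: "exclusion_graph f n H" and injL: "inj L" and per: "periodic_order n L l"
    and arcs: "\<And>a. Order (n + 1) (\<lambda>j. L (j + a - 1)) \<in> arcs H"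
    and i: "i < n" and "l > 0"
    and no1: "(i, l + i) \<notin> (Restr (step n L) {..<l + n})\<^sup>*"
    and no2: "(l + i, i) \<notin> (Restr (step n L) {..<l + n})\<^sup>*"
    and "n \<le> N" and N: "i + K * l < N"
  shows "fact K \<le> card (patterns N f)"
proof -
  \<comment> \<open>The copies are counted from \<open>1\<close> to match the indices of
    \<open>Sym K\<close>.\<close>
  define A where "A = (\<lambda>k. i + k * l) ` {1..K}"
  have anti: "a = b" if "a \<in> A" "b \<in> A" "(a, b) \<in> (step n L)\<^sup>*" for a b
    using that driftless_antichain[OF per i no1 no2] unfolding A_def by auto
  define R where "R \<tau> y \<longleftrightarrow> inj y \<and> (\<forall>k\<in>{1..K}. y (i + k * l) = real (\<tau> k)) \<and>
      (\<forall>u v. u \<le> v + n \<longrightarrow> v \<le> u + n \<longrightarrow> (y u < y v \<longleftrightarrow> L u < L v))"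
    for \<tau> :: perm and y :: "nat \<Rightarrow> real"
  have ex: "\<exists>y. R \<tau> y" if "\<tau> \<in> Sym K" for \<tau>
  proof -
    \<comment> \<open>Division by \<open>l\<close> recovers \<open>k\<close> from
      \<open>i + k * l\<close>.\<close>
    define w where "w x = real (\<tau> ((x - i) div l))" for x
    have w: "w (i + k * l) = real (\<tau> k)" for k using \<open>l > 0\<close> unfolding w_def by simp
    have \<tau>: "\<tau> permutes {1..K}" using that by (simp add: Sym_def)
    have "inj_on w A" unfolding A_def
      by (rule inj_onI) (auto simp: w dest: injD[OF permutes_inj[OF \<tau>]])
    moreover have "0 < w a \<and> w a \<le> real K" if "a \<in> A" for a
    proof -
      obtain k where k: "k \<in> {1..K}" "w a = real (\<tau> k)"
        using \<open>a \<in> A\<close> w unfolding A_def by blast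
      then have "\<tau> k \<in> {1..K}" using permutes_in_image[OF \<tau>] by blast
      then show ?thesis using k by simp
    qed
    ultimately obtain y :: "nat \<Rightarrow> real" where "inj y" "\<forall>a\<in>A. y a = w a"
        "\<forall>u v. u \<le> v + n \<longrightarrow> v \<le> u + n \<longrightarrow> (y u < y v \<longleftrightarrow> L u < L v)"
      using ex_reordering_of_antichain[of L w A "real K" n] injL anti by blast
    moreover from this(2) have "\<forall>k\<in>{1..K}. y (i + k * l) = real (\<tau> k)"
      unfolding A_def by (simp add: w)
    ultimately show ?thesis unfolding R_def by blast
  qed
  define y where "y \<tau> = (SOME y. R \<tau> y)" for \<tau>
  have Ry: "R \<tau> (y \<tau>)" if "\<tau> \<in> Sym K" for \<tau>
    unfolding y_def using ex[OF that] by (rule someI_ex)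
  have injy: "inj (y \<tau>)" if "\<tau> \<in> Sym K" for \<tau>
    using Ry[OF that] unfolding R_def by blast
  have yA: "y \<tau> (i + k * l) = real (\<tau> k)" if "\<tau> \<in> Sym K" "k \<in> {1..K}" for \<tau> k
    using Ry[OF that(1)] that(2) unfolding R_def by blast
  have yL: "y \<tau> u < y \<tau> v \<longleftrightarrow> L u < L v" if "\<tau> \<in> Sym K" "u \<le> v + n" "v \<le> u + n" for \<tau> u v
    using Ry[OF that(1)] that(2,3) unfolding R_def by blast
  \<comment> \<open>\<open>Order\<close> reads tuples from index \<open>1\<close>, whereas
    \<open>y \<tau>\<close> starts at \<open>0\<close>.\<close>
  define Z where "Z \<tau> j = y \<tau> (j - 1)" for \<tau> j
  have injZ: "inj_on (Z \<tau>) {1..}" if "\<tau> \<in> Sym K" for \<tau>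
  proof (rule inj_onI)
    fix p q :: nat assume pq: "p \<in> {1..}" "q \<in> {1..}" and "Z \<tau> p = Z \<tau> q"
    then have "p - 1 = q - 1" using injD[OF injy[OF that]] unfolding Z_def by blast
    then show "p = q" using pq by auto
  qed
  have mem: "Order N (Z \<tau>) \<in> patterns N f" if \<tau>: "\<tau> \<in> Sym K" for \<tau>
  proof (rule pattern_from_windows[OF H injZ[OF \<tau>] \<open>n \<le> N\<close>])
    fix a
    have injLa: "inj_on (\<lambda>j. L (j + a - 1)) {1..n + 1}"
    proof (rule inj_onI)
      fix p q assume pq: "p \<in> {1..n + 1}" "q \<in> {1..n + 1}" and "L (p + a - 1) = L (q + a - 1)"
      then have "p + a - 1 = q + a - 1" using injD[OF injL] by blast
      then show "p = q" using pq by auto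
    qed
    have "Order (n + 1) (\<lambda>j. Z \<tau> (j + a)) = Order (n + 1) (\<lambda>j. L (j + a - 1))"
    proof (rule Order_eqI[OF Order_in_Sym[OF injLa]])
      fix c d assume cd: "c \<in> {1..n + 1}" "d \<in> {1..n + 1}"
      then have "Z \<tau> (c + a) < Z \<tau> (d + a) \<longleftrightarrow> y \<tau> (c + a - 1) < y \<tau> (d + a - 1)"
        unfolding Z_def by simp
      also have "\<dots> \<longleftrightarrow> L (c + a - 1) < L (d + a - 1)"
        using cd by (intro yL[OF \<tau>]) auto
      finally show "Z \<tau> (c + a) < Z \<tau> (d + a) \<longleftrightarrow>
          Order (n + 1) (\<lambda>j. L (j + a - 1)) c < Order (n + 1) (\<lambda>j. L (j + a - 1)) d"
        using Order_less_iff[OF injLa cd] by simp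
    qed
    then show "Order (n + 1) (\<lambda>j. Z \<tau> (j + a)) \<in> arcs H" using arcs by simp
  qed
  have "inj_on (\<lambda>\<tau>. Order N (Z \<tau>)) (Sym K)"
  proof (rule inj_onI)
    fix \<tau> \<tau>' assume \<tau>: "\<tau> \<in> Sym K" "\<tau>' \<in> Sym K" and eq: "Order N (Z \<tau>) = Order N (Z \<tau>')"
    have cmp: "Order N (Z \<tau>) (i + p * l + 1) < Order N (Z \<tau>) (i + q * l + 1) \<longleftrightarrow> \<tau> p < \<tau> q"
      if "p \<in> {1..K}" "q \<in> {1..K}" "\<tau> \<in> Sym K" for p q \<tau>
    proof -
      have idx: "i + p * l + 1 \<in> {1..N}" if "p \<in> {1..K}" for p
      proof -
        have "p * l \<le> K * l" using that by simp
        then have "i + p * l + 1 \<le> N" using N by linarith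
        then show ?thesis by simp
      qed
      have "inj_on (Z \<tau>) {1..N}" using injZ[OF that(3)] by (rule inj_on_subset) auto
      then have "Order N (Z \<tau>) (i + p * l + 1) < Order N (Z \<tau>) (i + q * l + 1) \<longleftrightarrow>
          Z \<tau> (i + p * l + 1) < Z \<tau> (i + q * l + 1)"
        using idx that by (intro Order_less_iff) auto
      also have "\<dots> \<longleftrightarrow> y \<tau> (i + p * l) < y \<tau> (i + q * l)"
        unfolding Z_def by simp
      also have "\<dots> \<longleftrightarrow> \<tau> p < \<tau> q" using yA that by simp
      finally show ?thesis .
    qed
    \<comment> \<open>By \<open>cmp\<close>, the common pattern makes \<open>\<tau>\<close> and
      \<open>\<tau>'\<close> compare alike, so both are the order pattern of
      \<open>\<tau>'\<close>.\<close>
    have "Order K \<tau>' = \<tau>"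
    proof (rule Order_eqI[OF \<tau>(1)])
      fix p q assume pq: "p \<in> {1..K}" "q \<in> {1..K}"
      show "\<tau>' p < \<tau>' q \<longleftrightarrow> \<tau> p < \<tau> q"
        using cmp[OF pq \<tau>(1)] cmp[OF pq \<tau>(2)] unfolding eq by simp
    qed
    moreover have "Order K \<tau>' = \<tau>'" using \<tau> by (intro Order_eqI) auto
    ultimately show "\<tau> = \<tau>'" by simp
  qed
  moreover have "(\<lambda>\<tau>. Order N (Z \<tau>)) ` Sym K \<subseteq> patterns N f" using mem by blast
  moreover have "finite (patterns N f)"
  proof (rule finite_subset)
    show "patterns N f \<subseteq> Sym N" using H \<open>n \<le> N\<close> unfolding exclusion_graph_def by auto
    show "finite (Sym N)" unfolding Sym_def by (simp add: finite_permutations)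
  qed
  ultimately have "card (Sym K) \<le> card (patterns N f)" by (rule card_inj_on_le)
  moreover have "card (Sym K) = fact K"
    unfolding Sym_def using card_permutations[of "{1..K}" K] by simp
  ultimately show ?thesis by simp
qed

text \<open>With \<open>K = (N - n) div l\<close>, \<open>c ^ N\<close> is at most a constant times
  \<open>(C ^ l) ^ K\<close>, and the terms of the exponential series tend to
  \<open>0\<close>.\<close>

lemma eventually_fact_div_gt_power:
  fixes c :: real
  assumes "l > 0"
  shows "\<forall>\<^sub>F N in sequentially. c ^ N < fact ((N - n) div l)"
proof -
  \<comment> \<open>A base of at least \<open>1\<close> makes powers grow with the exponent; the
    absolute value covers negative \<open>c\<close>.\<close>
  define C where "C = max 1 \<bar>c\<bar>"
  have C: "1 \<le> C" "\<bar>c\<bar> \<le> C" unfolding C_def by auto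
  have "(\<lambda>K. (C ^ l) ^ K / fact K) \<longlonglongrightarrow> 0"
    using summable_LIMSEQ_zero[OF summable_exp[of "C ^ l"]] by (simp add: field_simps)
  then have ev: "\<forall>\<^sub>F K in sequentially. (C ^ l) ^ K / fact K < 1 / C ^ (n + l)"
    using C by (intro order_tendstoD(2)) auto
  have "filterlim (\<lambda>N. (N - n) div l) sequentially sequentially"
    unfolding filterlim_at_top
  proof
    fix M
    show "\<forall>\<^sub>F N in sequentially. M \<le> (N - n) div l"
      using eventually_ge_at_top[of "n + M * l"]
      by eventually_elim (use assms in \<open>simp add: less_eq_div_iff_mult_less_eq\<close>)
  qed
  then have "\<forall>\<^sub>F N in sequentially. (C ^ l) ^ ((N - n) div l) / fact ((N - n) div l) < 1 / C ^ (n + l)"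
    using ev by (rule filterlim_iff[THEN iffD1, rule_format])
  then show ?thesis
  proof eventually_elim
    case (elim N)
    let ?K = "(N - n) div l"
    \<comment> \<open>The summand \<open>l\<close> absorbs the remainder of the division.\<close>
    have "N \<le> n + l + l * ?K"
      using mult_div_mod_eq[of l "N - n"] mod_less_divisor[OF assms, of "N - n"] by linarith
    have "c ^ N \<le> \<bar>c\<bar> ^ N" by (metis abs_ge_self power_abs)
    also have "\<dots> \<le> C ^ N" using C by (intro power_mono) auto
    also have "\<dots> \<le> C ^ (n + l + l * ?K)"
      using C \<open>N \<le> n + l + l * ?K\<close> by (intro power_increasing) auto
    also have "\<dots> = C ^ (n + l) * (C ^ l) ^ ?K" by (simp add: power_add power_mult)
    also have "\<dots> < fact ?K" using elim C by (simp add: field_simps)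
    finally show ?case .
  qed
qed


section \<open>Unrolling a loop\<close>

text \<open>The arcs of the loop, repeated with period \<open>l\<close>, serve as ranks. They agree
  on overlaps, as \<open>ex_realization\<close> requires, because the head of each arc is the tail
  of the next.\<close>

lemma ex_periodic_realization:
  assumes H: "subgraph H (perm_digraph n)" and loop: "(vs, es) \<in> Loop l H" and "l > 0"
  shows "\<exists>L::nat \<Rightarrow> real. inj L \<and>
    (\<forall>a. \<forall>c\<le>n. \<forall>d\<le>n. L (a + c) < L (a + d) \<longleftrightarrow> (es ! (a mod l)) (c + 1) < (es ! (a mod l)) (d + 1))"
proof (rule ex_realization[where E = "\<lambda>a c. (es ! (a mod l)) (c + 1)"])
  have len: "length es = l" "length vs = l + 1" and last: "last vs = hd vs"
    and th: "\<And>j. j < l \<Longrightarrow> tail H (es ! j) = vs ! j \<and> head H (es ! j) = vs ! (j + 1)"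
    using loop unfolding Loop_def Path_def by auto
  have tlhd: "tail H = \<rho> n" "head H = \<rho>' n"
    using H by (auto simp: subgraph_def compatible_def perm_digraph_def)
  have Sym: "es ! (a mod l) permutes {1..n + 1}" for a
  proof -
    have "es ! (a mod l) \<in> set es" using len \<open>l > 0\<close> by simp
    then show ?thesis
      using loop H unfolding Loop_def Path_def subgraph_def perm_digraph_def Sym_def by auto
  qed
  show "inj_on (\<lambda>c. (es ! (a mod l)) (c + 1)) {..n}" for a
    by (rule inj_onI) (use injD[OF permutes_inj[OF Sym]] in force)
  fix a c d assume cd: "c < n" "d < n"
  \<comment> \<open>The passage from the last arc back to the first is where the loop has to close
    up.\<close>
  have wrap: "vs ! (a mod l + 1) = vs ! (Suc a mod l)"
  proof (cases "Suc (a mod l) = l")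
    case True
    then have "Suc a mod l = 0" by (simp add: mod_Suc)
    moreover have "vs ! l = vs ! 0"
      using last len by (metis One_nat_def add_diff_cancel_right' hd_conv_nth last_conv_nth length_0_conv nat.simps(3) Suc_eq_plus1)
    ultimately show ?thesis using True by simp
  next
    case False
    then show ?thesis by (simp add: mod_Suc)
  qed
  have eq: "\<rho>' n (es ! (a mod l)) = \<rho> n (es ! (Suc a mod l))"
    using th[of "a mod l"] th[of "Suc a mod l"] wrap \<open>l > 0\<close> unfolding tlhd by simp
  have "(es ! (a mod l)) (Suc c + 1) < (es ! (a mod l)) (Suc d + 1) \<longleftrightarrow>
      \<rho>' n (es ! (a mod l)) (c + 1) < \<rho>' n (es ! (a mod l)) (d + 1)"
    unfolding \<rho>'_def
  proof (subst Order_less_iff)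
    show "inj_on (\<lambda>i. (es ! (a mod l)) (i + 1)) {1..n}"
      by (rule inj_onI) (use injD[OF permutes_inj[OF Sym]] in force)
  qed (use cd in auto)
  also have "\<dots> \<longleftrightarrow> (es ! (Suc a mod l)) (c + 1) < (es ! (Suc a mod l)) (d + 1)"
    unfolding eq \<rho>_def
    by (rule Order_less_iff) (use cd permutes_inj_on[OF Sym] in auto)
  finally show "(es ! (a mod l)) (Suc c + 1) < (es ! (a mod l)) (Suc d + 1) \<longleftrightarrow>
      (es ! (Suc a mod l)) (c + 1) < (es ! (Suc a mod l)) (d + 1)" .
qed

text \<open>Links \<open>step\<close> to the drift: inside \<open>{..<l + n}\<close> every step fits
  into the window of one edge of the loop. Indices in \<open>Q_le\<close> start at \<open>1\<close>,
  hence the shift.\<close>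

lemma step_rtrancl_imp_Q_le:
  assumes len: "length es = l" and "l > 0"
    and L: "\<And>a c d. c \<le> n \<Longrightarrow> d \<le> n \<Longrightarrow>
      L (a + c) < L (a + d) \<longleftrightarrow> (es ! (a mod l)) (c + 1) < (es ! (a mod l)) (d + 1)"
    and "(a, b) \<in> (Restr (step n L) {..<l + n})\<^sup>*"
  shows "Q_le n (vs, es) (a + 1) (b + 1)"
  using assms(4) unfolding Q_le_def
proof (induction rule: rtrancl_induct)
  case (step y z)
  \<comment> \<open>The last edge starts at \<open>l - 1\<close>; pairs beyond that start are put
    into its window, which reaches up to \<open>l + n - 1\<close>.\<close>
  define m where "m = min (min y z) (l - 1)"
  define c d where "c = y - m" and "d = z - m"
  have m: "m < l" "y = m + c" "z = m + d" "c \<le> n" "d \<le> n"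
    using step.hyps(2) \<open>l > 0\<close> unfolding m_def c_def d_def by (auto simp: step_iff min_def)
  have "\<not> L (m + d) < L (m + c)" using step.hyps(2) m by (auto simp: step_iff)
  then have "(es ! m) (c + 1) \<le> (es ! m) (d + 1)" using L[of d c m] m by auto
  then have "(Suc m - 1 + (c + 1), Suc m - 1 + (d + 1)) \<in> Q_gen n (vs, es)"
    unfolding Q_gen_def prod.case using m len
    by (intro UnI2 CollectI exI[of _ "Suc m"] exI[of _ "c + 1"] exI[of _ "d + 1"]) auto
  then have "(y + 1, z + 1) \<in> Q_gen n (vs, es)" using m by simp
  then show ?case using step.IH by (rule rtrancl.rtrancl_into_rtrancl[rotated])
qed simp

theorem theorem6p3:
  fixes f :: "real \<Rightarrow> real" and n :: nat and H :: "(perm, perm) pre_digraph"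
  assumes "f \<in> \<A>"
    and "exclusion_graph f n H"
    and "\<exists>l\<ge>1. \<exists>\<gamma>\<in>Loop l H. partially_driftless n \<gamma>"
  shows "\<forall>c::real. \<forall>\<^sub>F N in sequentially. real (card (patterns N f)) > c ^ N"
proof
  fix c :: real
  obtain l vs es where l: "l > 0" and loop: "(vs, es) \<in> Loop l H"
    and pd: "partially_driftless n (vs, es)"
    using assms(3) by (auto simp: Suc_le_eq)
  have len: "length es = l" and es: "set es \<subseteq> arcs H"
    using loop unfolding Loop_def Path_def by auto
  have H: "subgraph H (perm_digraph n)" using assms(2) unfolding exclusion_graph_def by blast
  obtain i' where i': "i' \<in> {1..n}" "Drift n (vs, es) i' = Zero"
    using pd unfolding partially_driftless_def by blast
  define i where "i = i' - 1"
  have i: "i < n" "i' = i + 1" using i' unfolding i_def by auto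
  have no: "\<not> Q_le n (vs, es) (i + 1) (l + i + 1)" "\<not> Q_le n (vs, es) (l + i + 1) (i + 1)"
    using i' len unfolding Drift_def i by (auto split: if_splits)
  obtain L :: "nat \<Rightarrow> real" where injL: "inj L" and
    L: "\<And>a c d. c \<le> n \<Longrightarrow> d \<le> n \<Longrightarrow>
      L (a + c) < L (a + d) \<longleftrightarrow> (es ! (a mod l)) (c + 1) < (es ! (a mod l)) (d + 1)"
    using ex_periodic_realization[OF H loop l] by blast
  have per: "periodic_order n L l"
    unfolding periodic_order_def
  proof (intro allI impI)
    fix a b :: nat assume ab: "a \<le> b + n" "b \<le> a + n"
    \<comment> \<open>Both indices lie in the window at \<open>m\<close>, and the windows at
      \<open>m\<close> and \<open>m + l\<close> carry the same arc.\<close>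
    define m where "m = min a b"
    have "L (m + l + (b - m)) < L (m + l + (a - m)) \<longleftrightarrow> L (m + (b - m)) < L (m + (a - m))"
      using L[of "b - m" "a - m" "m + l"] L[of "b - m" "a - m" m] ab unfolding m_def by auto
    moreover have "m + l + (b - m) = b + l" "m + l + (a - m) = a + l" "m + (b - m) = b" "m + (a - m) = a"
      unfolding m_def by auto
    ultimately show "L (a + l) \<le> L (b + l) \<longleftrightarrow> L a \<le> L b" by (simp add: not_less[symmetric])
  qed
  have arcs: "Order (n + 1) (\<lambda>j. L (j + a - 1)) \<in> arcs H" for a
  proof -
    have mem: "es ! (a mod l) \<in> arcs H" using es len l by (metis mod_less_divisor nth_mem subsetD)
    moreover have "arcs H \<subseteq> Sym (n + 1)" using H by (auto simp: subgraph_def perm_digraph_def)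
    moreover have "L (p + a - 1) < L (q + a - 1) \<longleftrightarrow> (es ! (a mod l)) p < (es ! (a mod l)) q"
      if "p \<in> {1..n + 1}" "q \<in> {1..n + 1}" for p q
      using L[of "p - 1" "q - 1" a] that by (auto simp: add.commute)
    ultimately have "Order (n + 1) (\<lambda>j. L (j + a - 1)) = es ! (a mod l)"
      by (intro Order_eqI) auto
    then show ?thesis using mem by simp
  qed
  have no': "(i, l + i) \<notin> (Restr (step n L) {..<l + n})\<^sup>*" "(l + i, i) \<notin> (Restr (step n L) {..<l + n})\<^sup>*"
    using no step_rtrancl_imp_Q_le[OF len l L] by blast+
  show "\<forall>\<^sub>F N in sequentially. real (card (patterns N f)) > c ^ N"
    using eventually_fact_div_gt_power[OF l, of c n] eventually_ge_at_top[of n]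
  proof eventually_elim
    case (elim N)
    \<comment> \<open>With \<open>K = (N - n) div l\<close>, the last copy fits:
      \<open>i + K * l < n + (N - n) = N\<close>.\<close>
    have "(N - n) div l * l \<le> N - n" by simp
    then have "i + (N - n) div l * l < N" using i elim by linarith
    then have "fact ((N - n) div l) \<le> card (patterns N f)"
      using card_patterns_ge_fact[OF assms(2) injL per arcs i(1) l no' elim(2)] by blast
    then have "fact ((N - n) div l) \<le> real (card (patterns N f))"
      by (metis of_nat_fact of_nat_le_iff)
    then show ?case using elim by linarith
  qed
qed

end
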